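(* Let $G=\mathbb{Z}_{p^2}$ for a prime $p$, let $S$ be a proper subset of $G\setminus\{0\}$ that generates $G$, and let $S_0=S\cup\{0\}$. Let $0\in C\subseteq G$. Then $C$ is a perfect code in $\mathrm{Cay}(G,S)$ if and only if $S_0=\{i+\alpha_ip\mid i\in[p]\}$ for some $\alpha_i$'s in $\mathbb{Z}_{p^2}$ with $\alpha_0=0$ and $C=\{ip\mid i\in[p]\}$.
   Context: Groups are finite abelian, written additively; $\mathbb{Z}_n$ is the group of integers modulo $n$ and $[n]=\{0,1,\dots,n-1\}$. For $S\subseteq G\setminus\{0\}$, $\mathrm{Cay}(G,S)$ is the directed graph with vertex set $G$ and an arc from $x$ to $y$ if and only if $y-x\in S$ ($S$ is not assumed to be inverse-closed). A subset $C\subseteq G$ is a perfect code in $\mathrm{Cay}(G,S)$ if the sets $\{c\}\cup\{v:\text{there is an arc from } c \text{ to } v\}$, $c\in C$, form a partition of $G$. *)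

theory Defs
  imports
    "HOL-Algebra.Elementary_Groups"
    "HOL-Library.Disjoint_Sets"
    "HOL-Computational_Algebra.Primes"
    "Graph_Theory.Pair_Digraph"
begin

text \<open>
  Groups follow HOL-Algebra's multiplicative convention: for the additive group
  \<^term>\<open>integer_mod_group n\<close> the operation is addition modulo \<^term>\<open>n\<close>,
  the unit is 0, and the condition below is \<open>y - x \<in> S\<close>.
\<close>

definition cayley_digraph :: "('a, 'b) monoid_scheme \<Rightarrow> 'a set \<Rightarrow> 'a pair_pre_digraph" where
  "cayley_digraph G S =
     \<lparr> pverts = carrier G,
       parcs = {(x, y). x \<in> carrier G \<and> y \<in> carrier G \<and> y \<otimes>\<^bsub>G\<^esub> inv\<^bsub>G\<^esub> x \<in> S} \<rparr>"

definition closed_out_nbhd :: "('a, 'b) pre_digraph \<Rightarrow> 'a \<Rightarrow> 'a set" where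
  "closed_out_nbhd D c = {c} \<union> {v. c \<rightarrow>\<^bsub>D\<^esub> v}"

text \<open>
  The partition is that of an indexed family: distinct \<open>c, c' \<in> C\<close> must have disjoint
  closed out-neighbourhoods (in particular not equal ones), so each vertex is covered
  exactly once.
\<close>

definition perfect_code :: "('a, 'b) pre_digraph \<Rightarrow> 'a set \<Rightarrow> bool" where
  "perfect_code D C \<longleftrightarrow>
     C \<subseteq> verts D \<and>
     disjoint_family_on (closed_out_nbhd D) C \<and>
     (\<Union>c\<in>C. closed_out_nbhd D c) = verts D"

end

theory Submission
  imports Defs "HOL-Number_Theory.Cong"
begin

text \<open>
  A perfect code in a Cayley digraph of \<open>Z_n\<close> is a tiling: every element of \<open>Z_n\<close> is \<open>s + c\<close> for
  exactly one \<open>s \<in> S \<union> {0}\<close> and \<open>c \<in> C\<close>. The theorem therefore rests on the fact that in a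
  factorization \<open>A + B\<close> of \<open>Z_{p^2}\<close> with nontrivial factors containing 0, one factor is the
  subgroup \<open>p Z_{p^2}\<close> (\<open>prime_square_factorization\<close>). The factor \<open>S \<union> {0}\<close> cannot be that
  subgroup, because \<open>S\<close> generates \<open>Z_{p^2}\<close>; hence \<open>C\<close> is. And \<open>p Z_{p^2}\<close> tiles with
  \<open>S \<union> {0}\<close> precisely when \<open>S \<union> {0}\<close> has one element in each class modulo \<open>p\<close>, which is
  what the shifted residues \<open>i + \<alpha>\<^sub>i p\<close> describe.

  The factorization result is an argument about generating polynomials over the field with \<open>p\<close>
  elements. There \<open>x^{p^2} - 1 = (x - 1)^{p^2}\<close>, so the polynomials of \<open>A\<close> and \<open>B\<close> have a product
  that vanishes at 1 to order at least \<open>p^2 - 1\<close>. As \<open>p^2 - 1 > 2 (p - 1)\<close>, one of the two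
  vanishes to order at least \<open>p\<close>, so it is divisible by \<open>(x - 1)^p = x^p - 1\<close>, which means that
  each class modulo \<open>p\<close> contains a multiple of \<open>p\<close> of its elements. Both factors have \<open>p\<close>
  elements, so this one lies in a single class, namely that of 0.

  The polynomials themselves do not appear below. The \<open>i\<close>-th Taylor coefficient at 1 of the
  polynomial of \<open>A\<close> is the binomial moment \<open>\<Sum>a\<in>A. a choose i\<close>, and all steps are carried out on
  these moments: Vandermonde's identity turns products of polynomials into convolutions of moments
  (\<open>prime_dvd_moment_convolution\<close>, \<open>convolution_vanishing_dichotomy\<close>), and the moments below \<open>p\<close>
  determine the sizes of the residue classes modulo \<open>p\<close> (\<open>prime_dvd_residue_class_card\<close>).
\<close>

section \<open>Binomial coefficients modulo a prime\<close>

lemma prime_dvd_prime_power_choose: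
  fixes p :: nat
  assumes "prime p" "0 < j" "j < p ^ k"
  shows "p dvd (p ^ k choose j)"
proof (rule ccontr)
  \<comment> \<open>In \<open>j * (p^k choose j) = p^k * (p^k - 1 choose j - 1)\<close> the factor \<open>j\<close> cannot absorb all of \<open>p^k\<close>.\<close>
  assume "\<not> p dvd (p ^ k choose j)"
  then have "coprime (p ^ k) (p ^ k choose j)"
    using assms(1) by (simp add: prime_imp_coprime)
  moreover have "p ^ k dvd j * (p ^ k choose j)"
    using times_binomial_minus1_eq[OF assms(2), of "p ^ k"] by simp
  ultimately have "p ^ k dvd j"
    by (simp add: coprime_dvd_mult_left_iff)
  then show False
    using assms(2,3) by (auto dest: dvd_imp_le)
qed

lemma cong_choose_add_prime_power:
  fixes p :: nat
  assumes "prime p" "i < p ^ k"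
  shows "[(p ^ k + n) choose i = n choose i] (mod p)"
proof -
  have "p dvd (\<Sum>j\<in>{..i} - {0}. (p ^ k choose j) * (n choose (i - j)))"
    using assms by (intro dvd_sum dvd_mult2 prime_dvd_prime_power_choose) auto
  moreover have "(p ^ k + n) choose i =
      (n choose i) + (\<Sum>j\<in>{..i} - {0}. (p ^ k choose j) * (n choose (i - j)))"
    using sum.remove[of "{..i}" 0 "\<lambda>j. (p ^ k choose j) * (n choose (i - j))"]
    by (simp add: vandermonde)
  ultimately show ?thesis
    by (auto simp: cong_def elim!: dvdE)
qed

text \<open>
  This periodicity makes binomial moments below \<open>p^k\<close> well defined modulo \<open>p\<close> for subsets of
  the cyclic group of order \<open>p^k\<close>.
\<close>

lemma cong_choose_mod_prime_power:
  fixes p :: nat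
  assumes "prime p" "i < p ^ k"
  shows "[n choose i = (n mod p ^ k) choose i] (mod p)"
proof -
  have "[(p ^ k * q + r) choose i = r choose i] (mod p)" for q r
  proof (induction q)
    case (Suc q)
    have "[(p ^ k + (p ^ k * q + r)) choose i = (p ^ k * q + r) choose i] (mod p)"
      by (rule cong_choose_add_prime_power[OF assms])
    then show ?case
      using Suc by (auto simp: algebra_simps intro: cong_trans)
  qed simp
  from this[of "n div p ^ k" "n mod p ^ k"] show ?thesis by simp
qed

section \<open>Factorizations of the cyclic group of prime square order\<close>

text \<open>
  By Vandermonde's identity the convolution is the \<open>i\<close>-th moment of all sums \<open>a + b\<close>. Modulo \<open>p\<close>
  these sums may be reduced to run through \<open>{..<p ^ k}\<close> once, and the \<open>i\<close>-th moment of that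
  interval is \<open>p^k choose (i + 1)\<close>.
\<close>

lemma prime_dvd_moment_convolution:
  fixes p :: nat
  assumes "prime p" "Suc i < p ^ k"
    and bij: "bij_betw (\<lambda>(a, b). (a + b) mod p ^ k) (A \<times> B) {..<p ^ k}"
  shows "p dvd (\<Sum>j\<le>i. (\<Sum>a\<in>A. a choose j) * (\<Sum>b\<in>B. b choose (i - j)))"
proof -
  have "(\<Sum>j\<le>i. (\<Sum>a\<in>A. a choose j) * (\<Sum>b\<in>B. b choose (i - j)))
      = (\<Sum>j\<le>i. \<Sum>a\<in>A. \<Sum>b\<in>B. (a choose j) * (b choose (i - j)))"
    by (simp add: sum_product)
  also have "\<dots> = (\<Sum>a\<in>A. \<Sum>j\<le>i. \<Sum>b\<in>B. (a choose j) * (b choose (i - j)))"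
    by (rule sum.swap)
  also have "\<dots> = (\<Sum>a\<in>A. \<Sum>b\<in>B. \<Sum>j\<le>i. (a choose j) * (b choose (i - j)))"
    by (intro sum.cong refl sum.swap)
  also have "\<dots> = (\<Sum>(a, b)\<in>A \<times> B. (a + b) choose i)"
    by (simp add: vandermonde sum.cartesian_product)
  finally have eq: "(\<Sum>j\<le>i. (\<Sum>a\<in>A. a choose j) * (\<Sum>b\<in>B. b choose (i - j)))
      = (\<Sum>(a, b)\<in>A \<times> B. (a + b) choose i)" .
  have "[(\<Sum>(a, b)\<in>A \<times> B. (a + b) choose i)
      = (\<Sum>(a, b)\<in>A \<times> B. ((a + b) mod p ^ k) choose i)] (mod p)"
    using assms(1,2)
    by (intro cong_sum) (auto intro!: cong_choose_mod_prime_power)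
  also have "(\<Sum>(a, b)\<in>A \<times> B. ((a + b) mod p ^ k) choose i) = (\<Sum>g<p ^ k. g choose i)"
    using sum.reindex_bij_betw[OF bij, of "\<lambda>g. g choose i"] by (simp add: case_prod_unfold)
  also have "\<dots> = p ^ k choose Suc i"
    using sum_choose_upper[of i "p ^ k - 1"] assms(2)
    by (metis Suc_diff_1 lessThan_Suc_atMost less_nat_zero_code neq0_conv)
  finally show ?thesis
    unfolding eq using prime_dvd_prime_power_choose[OF assms(1) zero_less_Suc assms(2)]
    by (rule cong_dvd_iff[THEN iffD2])
qed

text \<open>
  Orders of vanishing add: if \<open>a\<close> and \<open>b\<close> are the first indices at which \<open>f\<close> and \<open>g\<close> are nonzero
  modulo \<open>p\<close>, then the term of index \<open>a + b\<close> of the convolution is \<open>f a * g b\<close> modulo \<open>p\<close>.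
\<close>

lemma convolution_vanishing_dichotomy:
  fixes f g :: "nat \<Rightarrow> nat" and p m :: nat
  assumes "prime p"
    and conv: "\<And>i. Suc i < 2 * m \<Longrightarrow> p dvd (\<Sum>j\<le>i. f j * g (i - j))"
  shows "(\<forall>j<m. p dvd f j) \<or> (\<forall>j<m. p dvd g j)"
proof (rule ccontr)
  assume "\<not> ?thesis"
  then obtain a0 b0 where ab0: "a0 < m" "\<not> p dvd f a0" "b0 < m" "\<not> p dvd g b0" by blast
  define a where "a = (LEAST j. \<not> p dvd f j)"
  define b where "b = (LEAST j. \<not> p dvd g j)"
  have a: "\<not> p dvd f a" "a \<le> a0" "\<And>j. j < a \<Longrightarrow> p dvd f j"
    unfolding a_def using ab0 LeastI[of "\<lambda>j. \<not> p dvd f j"] Least_le[of "\<lambda>j. \<not> p dvd f j"]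
    by (blast dest: not_less_Least)+
  have b: "\<not> p dvd g b" "b \<le> b0" "\<And>j. j < b \<Longrightarrow> p dvd g j"
    unfolding b_def using ab0 LeastI[of "\<lambda>j. \<not> p dvd g j"] Least_le[of "\<lambda>j. \<not> p dvd g j"]
    by (blast dest: not_less_Least)+
  have "p dvd f j * g (a + b - j)" if "j \<in> {..a + b} - {a}" for j
  proof (cases "j < a")
    case False
    then have "a + b - j < b" using that by auto
    then show ?thesis using b(3) by simp
  qed (simp add: a(3))
  then have "p dvd (\<Sum>j\<in>{..a + b} - {a}. f j * g (a + b - j))"
    by (rule dvd_sum)
  moreover have "p dvd (\<Sum>j\<le>a + b. f j * g (a + b - j))"
    using a(2) b(2) ab0 by (intro conv) linarith
  moreover have "(\<Sum>j\<le>a + b. f j * g (a + b - j))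
      = f a * g b + (\<Sum>j\<in>{..a + b} - {a}. f j * g (a + b - j))"
    by (subst sum.remove[of _ a]) auto
  ultimately have "p dvd f a * g b"
    by (simp add: dvd_add_left_iff)
  then show False
    using assms(1) a(1) b(1) by (simp add: prime_dvd_mult_iff)
qed

text \<open>
  Let \<open>N\<^sub>s\<close> be the size of the class of \<open>s\<close>. Below \<open>p\<close>, the \<open>t\<close>-th moment is
  \<open>\<Sum>s<p. N\<^sub>s * (s choose t)\<close> modulo \<open>p\<close>. This system is unitriangular, since
  \<open>s choose t\<close> is 0 for \<open>s < t\<close> and 1 for \<open>s = t\<close>; it is solved from \<open>t = p - 1\<close> downwards.
\<close>

lemma prime_dvd_residue_class_card:
  fixes p :: nat
  assumes "prime p" "finite A"
    and moments: "\<And>i. i < p \<Longrightarrow> p dvd (\<Sum>a\<in>A. a choose i)"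
    and "t < p"
  shows "p dvd card {a \<in> A. a mod p = t}"
  using \<open>t < p\<close>
proof (induction "p - t" arbitrary: t rule: less_induct)
  case less
  let ?N = "\<lambda>s. card {a \<in> A. a mod p = s}"
  have "[(\<Sum>a\<in>A. a choose t) = (\<Sum>a\<in>A. (a mod p) choose t)] (mod p)"
    using cong_choose_mod_prime_power[OF assms(1), of t 1] less.prems
    by (intro cong_sum) simp
  also have "(\<Sum>a\<in>A. (a mod p) choose t)
      = (\<Sum>s<p. \<Sum>a | a \<in> A \<and> a mod p = s. (a mod p) choose t)"
    using assms(2) prime_gt_0_nat[OF assms(1)] by (intro sum.group[symmetric]) auto
  also have "\<dots> = (\<Sum>s<p. ?N s * (s choose t))"
    by (intro sum.cong refl) simp
  also have "\<dots> = ?N t + (\<Sum>s\<in>{..<p} - {t}. ?N s * (s choose t))"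
    using less.prems by (subst sum.remove[of _ t]) auto
  finally have "p dvd ?N t + (\<Sum>s\<in>{..<p} - {t}. ?N s * (s choose t))"
    using moments[OF less.prems] by (rule cong_dvd_iff[THEN iffD1])
  moreover have "p dvd ?N s * (s choose t)" if "s \<in> {..<p} - {t}" for s
  proof (cases "s < t")
    case False
    then show ?thesis using less.hyps[of s] that by (intro dvd_mult2) auto
  qed (simp add: binomial_eq_0)
  then have "p dvd (\<Sum>s\<in>{..<p} - {t}. ?N s * (s choose t))"
    by (rule dvd_sum)
  ultimately show ?case
    by (simp add: dvd_add_left_iff)
qed

lemma eq_multiples_of_prime:
  fixes p :: nat
  assumes "prime p" "A \<subseteq> {..<p ^ 2}" "card A = p" "0 \<in> A"
    and "\<And>i. i < p \<Longrightarrow> p dvd (\<Sum>a\<in>A. a choose i)"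
  shows "A = (\<lambda>i. i * p) ` {..<p}"
proof -
  have p: "p > 0" using assms(1) by (rule prime_gt_0_nat)
  have fin: "finite A" using assms(2) finite_subset by blast
  let ?Z = "{a \<in> A. a mod p = 0}"
  have "p dvd card ?Z"
    using assms(1,5) fin p by (intro prime_dvd_residue_class_card) auto
  moreover have "card ?Z > 0"
    using fin assms(4) by (auto simp: card_gt_0_iff)
  ultimately have "card A \<le> card ?Z"
    using assms(3) by (simp add: dvd_imp_le)
  then have Z: "?Z = A"
    using fin by (intro card_seteq) auto
  have "A \<subseteq> (\<lambda>i. i * p) ` {..<p}"
  proof
    fix a assume a: "a \<in> A"
    then have "p dvd a" using Z by auto
    then obtain i where i: "a = i * p" by (metis dvd_def mult.commute)
    have "i < p" using a assms(2) i p by (auto simp: power2_eq_square)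
    then show "a \<in> (\<lambda>i. i * p) ` {..<p}" using i by blast
  qed
  moreover have "card ((\<lambda>i. i * p) ` {..<p}) = p"
    using p by (subst card_image) (auto simp: inj_on_def)
  ultimately show ?thesis
    using assms(3) by (intro card_subset_eq) auto
qed

text \<open>
  The cardinality conditions exclude the trivial factorizations and leave \<open>p\<close> as the only size of
  both factors. The moment argument then shows that one of them is the subgroup of order \<open>p\<close>.
\<close>

theorem prime_square_factorization:
  fixes p :: nat and A B :: "nat set"
  assumes "prime p" "A \<subseteq> {..<p ^ 2}" "B \<subseteq> {..<p ^ 2}" "0 \<in> A" "0 \<in> B"
    and bij: "bij_betw (\<lambda>(a, b). (a + b) mod p ^ 2) (A \<times> B) {..<p ^ 2}"
    and "card A \<noteq> 1" "card A \<noteq> p ^ 2"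
  shows "A = (\<lambda>i. i * p) ` {..<p} \<or> B = (\<lambda>i. i * p) ` {..<p}"
proof -
  have p: "p \<ge> 2" using assms(1) by (rule prime_ge_2_nat)
  have card: "card A * card B = p ^ 2"
    using bij_betw_same_card[OF bij] by (simp add: card_cartesian_product)
  then obtain k where "k \<le> 2" "card A = p ^ k"
    using divides_primepow_nat[OF assms(1), of "card A" 2] by (metis dvd_triv_left)
  moreover from this have "k = 1"
    using assms(7,8) by (cases "k = 0"; cases "k = 2") auto
  ultimately have cA: "card A = p" by simp
  with card p have cB: "card B = p" by (simp add: power2_eq_square)
  have "(\<forall>j<p. p dvd (\<Sum>a\<in>A. a choose j)) \<or> (\<forall>j<p. p dvd (\<Sum>b\<in>B. b choose j))"
  proof (rule convolution_vanishing_dichotomy[OF assms(1)])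
    \<comment> \<open>First nonvanishing indices below \<open>p\<close> add up to at most \<open>2 p - 2\<close>, which is below \<open>p\<^sup>2 - 1\<close>.\<close>
    fix i assume "Suc i < 2 * p"
    moreover have "2 * p \<le> p ^ 2" using p by (simp add: power2_eq_square)
    ultimately show "p dvd (\<Sum>j\<le>i. (\<Sum>a\<in>A. a choose j) * (\<Sum>b\<in>B. b choose (i - j)))"
      by (intro prime_dvd_moment_convolution[OF assms(1) _ bij]) simp
  qed
  then show ?thesis
    using eq_multiples_of_prime[OF assms(1)] assms(2-5) cA cB by metis
qed

lemma prime_square_factorization_int:
  fixes p :: nat and A B :: "int set"
  assumes "prime p" "A \<subseteq> {0..<int (p ^ 2)}" "B \<subseteq> {0..<int (p ^ 2)}" "0 \<in> A" "0 \<in> B"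
    and bij: "bij_betw (\<lambda>(a, b). (a + b) mod int (p ^ 2)) (A \<times> B) {0..<int (p ^ 2)}"
    and "A \<noteq> {0}" "A \<noteq> {0..<int (p ^ 2)}"
  shows "A = (\<lambda>i. int i * int p) ` {..<p} \<or> B = (\<lambda>i. int i * int p) ` {..<p}"
proof -
  define A' where "A' = nat ` A"
  define B' where "B' = nat ` B"
  have A: "A = int ` A'" and B: "B = int ` B'"
    unfolding A'_def B'_def using assms(2,3) by (force simp: image_image)+
  have sub: "A' \<subseteq> {..<p ^ 2}" "B' \<subseteq> {..<p ^ 2}"
    using assms(2,3) unfolding A B by (auto simp flip: of_nat_power)
  have zero: "0 \<in> A'" "0 \<in> B'" using assms(4,5) unfolding A B by auto
  have fin: "finite A'" using sub(1) finite_subset by blast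
  have range: "{0..<int (p ^ 2)} = int ` {..<p ^ 2}"
    by (auto simp: image_int_atLeastLessThan lessThan_atLeast0)
  have "bij_betw (\<lambda>(a, b). (int a + int b) mod int (p ^ 2)) (A' \<times> B') (int ` {..<p ^ 2})"
  proof -
    have "bij_betw (map_prod int int) (A' \<times> B') (A \<times> B)"
      unfolding A B by (intro bij_betw_imageI) (auto simp: inj_on_def)
    from bij_betw_trans[OF this bij] show ?thesis
      unfolding range by (simp add: comp_def case_prod_unfold)
  qed
  also have "(\<lambda>(a, b). (int a + int b) mod int (p ^ 2)) = int \<circ> (\<lambda>(a, b). (a + b) mod p ^ 2)"
    by (auto simp: zmod_int)
  finally have "bij_betw (nat \<circ> (int \<circ> (\<lambda>(a, b). (a + b) mod p ^ 2))) (A' \<times> B') {..<p ^ 2}"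
    by (rule bij_betw_trans) (auto intro!: bij_betw_imageI simp: inj_on_def image_image)
  then have bij': "bij_betw (\<lambda>(a, b). (a + b) mod p ^ 2) (A' \<times> B') {..<p ^ 2}"
    by (simp add: comp_def)
  have "card A' \<noteq> 1"
    using assms(7) zero(1) unfolding A by (auto simp: card_1_singleton_iff)
  moreover have "card A' \<noteq> p ^ 2"
    using assms(8) card_subset_eq[OF finite_lessThan sub(1)] unfolding A range by auto
  ultimately have "A' = (\<lambda>i. i * p) ` {..<p} \<or> B' = (\<lambda>i. i * p) ` {..<p}"
    by (intro prime_square_factorization assms(1) sub zero bij')
  then show ?thesis
    unfolding A B by (auto simp: image_image)
qed

section \<open>Perfect codes as tilings\<close>

lemma closed_out_nbhd_cayley:
  assumes "n > 0" "S \<subseteq> carrier (integer_mod_group n)" "c \<in> carrier (integer_mod_group n)"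
  shows "closed_out_nbhd (with_proj (cayley_digraph (integer_mod_group n) S)) c
    = (\<lambda>s. (s + c) mod int n) ` (S \<union> {0})"
proof -
  have c: "0 \<le> c" "c < int n" using assms(1,3) by (auto simp: carrier_integer_mod_group)
  have "v \<in> carrier (integer_mod_group n) \<and> (v + (- c) mod int n) mod int n \<in> S
      \<longleftrightarrow> v \<in> (\<lambda>s. (s + c) mod int n) ` S" for v
  proof
    assume v: "v \<in> carrier (integer_mod_group n) \<and> (v + (- c) mod int n) mod int n \<in> S"
    have "((v + (- c) mod int n) mod int n + c) mod int n = v"
      using v assms(1) by (simp add: mod_simps carrier_integer_mod_group)
    then show "v \<in> (\<lambda>s. (s + c) mod int n) ` S" using v by (metis imageI)
  next
    assume "v \<in> (\<lambda>s. (s + c) mod int n) ` S"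
    then obtain s where s: "s \<in> S" "v = (s + c) mod int n" by blast
    then have "(v + (- c) mod int n) mod int n = s"
      using assms(1,2) by (auto simp: mod_simps carrier_integer_mod_group)
    then show "v \<in> carrier (integer_mod_group n) \<and> (v + (- c) mod int n) mod int n \<in> S"
      using s assms(1) by (simp add: carrier_integer_mod_group)
  qed
  then show ?thesis
    using assms(3) c
    by (auto simp: closed_out_nbhd_def cayley_digraph_def)
qed

text \<open>
  The closed out-neighbourhood of \<open>c\<close> is the translate \<open>c + (S \<union> {0})\<close>. Translation is injective,
  so disjointness of the translates is injectivity of the addition map, and covering is its
  surjectivity.
\<close>

lemma perfect_code_iff_bij_betw:
  assumes "n > 0" "S \<subseteq> carrier (integer_mod_group n)" "C \<subseteq> carrier (integer_mod_group n)"
  shows "perfect_code (with_proj (cayley_digraph (integer_mod_group n) S)) C \<longleftrightarrow>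
    bij_betw (\<lambda>(s, c). (s + c) mod int n) ((S \<union> {0}) \<times> C) {0..<int n}"
    (is "?P \<longleftrightarrow> bij_betw ?f _ _")
proof -
  let ?D = "with_proj (cayley_digraph (integer_mod_group n) S)"
  let ?S = "S \<union> {0}"
  let ?g = "\<lambda>c. (\<lambda>s. (s + c) mod int n) ` ?S"
  have nb: "closed_out_nbhd ?D c = ?g c" if "c \<in> C" for c
    using closed_out_nbhd_cayley assms that by blast
  have V: "verts ?D = {0..<int n}"
    using assms(1) by (simp add: cayley_digraph_def carrier_integer_mod_group)
  have inj: "s = s'" if "s \<in> ?S" "s' \<in> ?S" "(s + c) mod int n = (s' + c) mod int n" for s s' c
  proof -
    have "s mod int n = s' mod int n"
      using mod_diff_cong[OF that(3) refl[of "c mod int n"]] by simp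
    moreover have "s mod int n = s" "s' mod int n = s'"
      using that(1,2) assms(1,2) by (auto simp: carrier_integer_mod_group)
    ultimately show ?thesis by simp
  qed
  have "disjoint_family_on (closed_out_nbhd ?D) C \<longleftrightarrow> disjoint_family_on ?g C"
    by (simp add: disjoint_family_on_def nb)
  also have "\<dots> \<longleftrightarrow> inj_on ?f (?S \<times> C)"
  proof
    assume disj: "disjoint_family_on ?g C"
    show "inj_on ?f (?S \<times> C)"
    proof (rule inj_onI, clarify)
      fix s c s' c'
      assume *: "s \<in> ?S" "c \<in> C" "s' \<in> ?S" "c' \<in> C" "(s + c) mod int n = (s' + c') mod int n"
      then have "(s + c) mod int n \<in> ?g c" "(s + c) mod int n \<in> ?g c'" by blast+
      then have "c = c'"
        using disjoint_family_onD[OF disj *(2,4)] by blast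
      then show "s = s' \<and> c = c'" using inj * by blast
    qed
  next
    assume inj: "inj_on ?f (?S \<times> C)"
    show "disjoint_family_on ?g C"
      unfolding disjoint_family_on_def
    proof (intro ballI impI)
      fix c c' assume "c \<in> C" "c' \<in> C" "c \<noteq> c'"
      then show "?g c \<inter> ?g c' = {}"
        using inj_onD[OF inj, of "(_, c)" "(_, c')"] by fastforce
    qed
  qed
  finally have dis: "disjoint_family_on (closed_out_nbhd ?D) C \<longleftrightarrow> inj_on ?f (?S \<times> C)" .
  have cover: "(\<Union>c\<in>C. closed_out_nbhd ?D c) = ?f ` (?S \<times> C)"
    using nb by (auto simp: image_iff)
  show ?thesis
    unfolding perfect_code_def bij_betw_def dis cover V
    using assms(1,3) by (auto simp: carrier_integer_mod_group)
qed

section \<open>Tilings by the subgroup of multiples\<close>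

lemma multiples_of_square_eq:
  fixes p :: nat
  assumes "p > 0"
  shows "(\<lambda>i. int i * int p) ` {..<p} = {b \<in> {0..<int (p ^ 2)}. int p dvd b}" (is "?L = ?R")
proof
  show "?L \<subseteq> ?R" by (auto simp: power2_eq_square)
  show "?R \<subseteq> ?L"
  proof
    fix b assume b: "b \<in> ?R"
    then obtain k where k: "b = int p * k" by (auto elim: dvdE)
    then have "0 \<le> k" "k < int p"
      using b assms by (auto simp: power2_eq_square zero_le_mult_iff)
    then show "b \<in> ?L"
      using k by (intro image_eqI[of _ _ "nat k"]) auto
  qed
qed

lemma bij_betw_multiples_iff_transversal:
  fixes p :: nat and A :: "int set"
  assumes "p > 0" "A \<subseteq> {0..<int (p ^ 2)}"
  shows "bij_betw (\<lambda>(a, b). (a + b) mod int (p ^ 2)) (A \<times> (\<lambda>i. int i * int p) ` {..<p})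
      {0..<int (p ^ 2)} \<longleftrightarrow> bij_betw (\<lambda>a. a mod int p) A {0..<int p}"
    (is "bij_betw ?f (A \<times> ?M) ?G \<longleftrightarrow> _")
proof
  have M: "?M = {b \<in> ?G. int p dvd b}"
    by (rule multiples_of_square_eq[OF assms(1)])
  have pp: "int p dvd int (p ^ 2)" by simp
  have pos: "int (p ^ 2) > 0" using assms(1) by simp
  have le: "int p \<le> int (p ^ 2)" using assms(1) by (simp add: power2_nat_le_imp_le self_le_power)
  have diff: "(g - a) mod int (p ^ 2) \<in> ?M" if "g mod int p = a mod int p" for g a
  proof -
    have "int p dvd (g - a) mod int (p ^ 2)"
      using that pp by (simp add: dvd_mod mod_eq_dvd_iff)
    then show ?thesis
      unfolding M using pos by simp
  qed
  have modp: "(a + b) mod int (p ^ 2) mod int p = a mod int p" if b: "b \<in> ?M" for a b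
  proof -
    obtain i where "b = int i * int p" using b by blast
    then show ?thesis by (simp only: mod_mod_cancel[OF pp] mod_mult_self1)
  qed
  {
    assume bij: "bij_betw ?f (A \<times> ?M) ?G"
    show "bij_betw (\<lambda>a. a mod int p) A {0..<int p}"
    proof (rule bij_betw_imageI)
      show "inj_on (\<lambda>a. a mod int p) A"
      proof (rule inj_onI)
        fix a a' assume *: "a \<in> A" "a' \<in> A" "a mod int p = a' mod int p"
        \<comment> \<open>The element \<open>a\<close> is represented both as \<open>a + 0\<close> and as \<open>a' + (a - a')\<close>.\<close>
        have "(a - a') mod int (p ^ 2) \<in> ?M" "0 \<in> ?M"
          using diff[OF *(3)] assms(1) by auto
        moreover have "?f (a, 0) = ?f (a', (a - a') mod int (p ^ 2))"
          by (simp add: mod_simps)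
        ultimately have "(a, 0) = (a', (a - a') mod int (p ^ 2))"
          using * by (intro inj_onD[OF bij_betw_imp_inj_on[OF bij]]) auto
        then show "a = a'" by simp
      qed
      show "(\<lambda>a. a mod int p) ` A = {0..<int p}"
      proof
        show "(\<lambda>a. a mod int p) ` A \<subseteq> {0..<int p}" using assms(1) by auto
        show "{0..<int p} \<subseteq> (\<lambda>a. a mod int p) ` A"
        proof
          fix r assume r: "r \<in> {0..<int p}"
          then have "r \<in> ?G" using le unfolding atLeastLessThan_iff by linarith
          then have "r \<in> ?f ` (A \<times> ?M)"
            using bij_betw_imp_surj_on[OF bij] by simp
          then obtain x where x: "r = ?f x" "x \<in> A \<times> ?M" by (rule imageE)
          then have "fst x \<in> A" "snd x \<in> ?M" by (simp_all only: mem_Times_iff)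
          moreover from this have "r mod int p = fst x mod int p"
            using modp x(1) by (simp only: case_prod_unfold)
          ultimately show "r \<in> (\<lambda>a. a mod int p) ` A"
            using r by auto
        qed
      qed
    qed
  next
    assume bij: "bij_betw (\<lambda>a. a mod int p) A {0..<int p}"
    show "bij_betw ?f (A \<times> ?M) ?G"
    proof (rule bij_betw_imageI)
      show "inj_on ?f (A \<times> ?M)"
      proof (rule inj_onI)
        fix x y assume xy: "x \<in> A \<times> ?M" "y \<in> A \<times> ?M" "?f x = ?f y"
        have A: "fst x \<in> A" "fst y \<in> A" and B: "snd x \<in> ?M" "snd y \<in> ?M"
          using xy(1,2) by (simp_all only: mem_Times_iff)
        have eq: "(fst x + snd x) mod int (p ^ 2) = (fst y + snd y) mod int (p ^ 2)"
          using xy(3) by (simp only: case_prod_unfold)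
        have "fst x mod int p = fst y mod int p"
          using modp[OF B(1), of "fst x"] modp[OF B(2), of "fst y"] eq by simp
        then have fst: "fst x = fst y"
          using bij_betw_imp_inj_on[OF bij] A by (auto dest: inj_onD)
        have "snd x mod int (p ^ 2) = snd y mod int (p ^ 2)"
          using mod_diff_cong[OF eq refl[of "fst x mod int (p ^ 2)"]] fst by simp
        then have "snd x = snd y"
          using B unfolding M by (simp only: mem_Collect_eq atLeastLessThan_iff mod_pos_pos_trivial)
        with fst show "x = y" by (rule prod_eqI)
      qed
      show "?f ` (A \<times> ?M) = ?G"
      proof
        show "?f ` (A \<times> ?M) \<subseteq> ?G" using pos by auto
        show "?G \<subseteq> ?f ` (A \<times> ?M)"
        proof
          fix g assume g: "g \<in> ?G"
          have "g mod int p \<in> (\<lambda>a. a mod int p) ` A"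
            using bij_betw_imp_surj_on[OF bij] assms(1) by auto
          then obtain a where a: "a \<in> A" "g mod int p = a mod int p" by blast
          have "?f (a, (g - a) mod int (p ^ 2)) = g"
            using g by (simp add: mod_simps)
          then show "g \<in> ?f ` (A \<times> ?M)"
            using a(1) diff[OF a(2)] by (metis (no_types, lifting) SigmaI imageI)
        qed
      qed
    qed
  }
qed

text \<open>
  The witness takes \<open>\<alpha> i\<close> to be the quotient by \<open>p\<close> of the representative of the class of \<open>i\<close>.
  The value \<open>\<alpha> 0 = 0\<close> expresses that 0 is the representative of its own class, which is where
  \<open>0 \<in> A\<close> enters.
\<close>

lemma transversal_iff_shifted_residues:
  fixes p :: nat and A :: "int set"
  assumes "p > 0" "A \<subseteq> {0..<int (p ^ 2)}" "0 \<in> A"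
  shows "bij_betw (\<lambda>a. a mod int p) A {0..<int p} \<longleftrightarrow>
    (\<exists>\<alpha> :: nat \<Rightarrow> int. (\<forall>i<p. \<alpha> i \<in> {0..<int (p ^ 2)}) \<and> \<alpha> 0 = 0 \<and>
      A = {(int i + \<alpha> i * int p) mod int (p ^ 2) | i. i < p})"
    (is "?B \<longleftrightarrow> (\<exists>\<alpha>. ?Q \<alpha>)")
proof
  assume bij: ?B
  define s where "s = inv_into A (\<lambda>a. a mod int p)"
  have s: "s (int i) \<in> A" "s (int i) mod int p = int i" if "i < p" for i
    using that bij_betw_imp_surj_on[OF bij] unfolding s_def
    by (auto intro!: inv_into_into f_inv_into_f[of _ "\<lambda>a. a mod int p"])
  have s_mod: "s (a mod int p) = a" if "a \<in> A" for a
    unfolding s_def using that bij_betw_imp_inj_on[OF bij] by (rule inv_into_f_f[rotated])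
  define \<alpha> where "\<alpha> i = s (int i) div int p" for i
  have eq: "(int i + \<alpha> i * int p) mod int (p ^ 2) = s (int i)" if "i < p" for i
  proof -
    have "int i + \<alpha> i * int p = s (int i)"
      unfolding \<alpha>_def using s(2)[OF that] by (metis add.commute div_mult_mod_eq)
    moreover have "s (int i) \<in> {0..<int (p ^ 2)}" using s(1)[OF that] assms(2) by blast
    ultimately show ?thesis by simp
  qed
  have "\<alpha> i \<in> {0..<int (p ^ 2)}" if "i < p" for i
  proof -
    have *: "s (int i) \<in> {0..<int (p ^ 2)}" using s(1)[OF that] assms(2) by blast
    then have "\<alpha> i \<le> s (int i)" "0 \<le> \<alpha> i"
      unfolding \<alpha>_def using assms(1)
      by (simp_all add: zdiv_mono2[of "s (int i)" 1 "int p", simplified] pos_imp_zdiv_nonneg_iff)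
    with * show ?thesis by simp
  qed
  moreover have "\<alpha> 0 = 0" using s_mod[OF assms(3)] by (simp add: \<alpha>_def)
  moreover have "A = {(int i + \<alpha> i * int p) mod int (p ^ 2) | i. i < p}"
  proof
    show "{(int i + \<alpha> i * int p) mod int (p ^ 2) | i. i < p} \<subseteq> A"
      using eq s(1) by auto
    show "A \<subseteq> {(int i + \<alpha> i * int p) mod int (p ^ 2) | i. i < p}"
    proof
      fix a assume a: "a \<in> A"
      let ?i = "nat (a mod int p)"
      have i: "int ?i = a mod int p" "?i < p" using assms(1) by (auto simp: nat_less_iff)
      have "a = (int ?i + \<alpha> ?i * int p) mod int (p ^ 2)"
        using eq[OF i(2)] s_mod[OF a] i(1) by simp
      then show "a \<in> {(int i + \<alpha> i * int p) mod int (p ^ 2) | i. i < p}"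
        using i(2) by blast
    qed
  qed
  ultimately show "\<exists>\<alpha>. ?Q \<alpha>" by blast
next
  assume "\<exists>\<alpha>. ?Q \<alpha>"
  then obtain \<alpha> where A: "A = (\<lambda>i. (int i + \<alpha> i * int p) mod int (p ^ 2)) ` {..<p}"
    by (auto simp: setcompr_eq_image)
  have pp: "int p dvd int (p ^ 2)" by simp
  have modp: "(int i + \<alpha> i * int p) mod int (p ^ 2) mod int p = int i" if "i < p" for i
    using that by (simp only: mod_mod_cancel[OF pp] mod_mult_self1) simp
  show ?B
  proof (rule bij_betw_imageI)
    show "inj_on (\<lambda>a. a mod int p) A"
    proof (rule inj_onI)
      fix a a' assume *: "a \<in> A" "a' \<in> A" "a mod int p = a' mod int p"
      obtain i i' where i: "i < p" "i' < p"
        "a = (int i + \<alpha> i * int p) mod int (p ^ 2)" "a' = (int i' + \<alpha> i' * int p) mod int (p ^ 2)"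
        using * A by blast
      have "int i = int i'" using *(3) modp i by metis
      then show "a = a'" using i by simp
    qed
    have "(\<lambda>a. a mod int p) ` A = int ` {..<p}"
      unfolding A image_image using modp by (intro image_cong) auto
    then show "(\<lambda>a. a mod int p) ` A = {0..<int p}"
      by (simp add: image_int_atLeastLessThan lessThan_atLeast0)
  qed
qed

lemma generate_multiples_neq_carrier:
  assumes "d dvd n" "d \<noteq> 1" "n > 0" "S \<subseteq> carrier (integer_mod_group n)" "\<And>s. s \<in> S \<Longrightarrow> int d dvd s"
  shows "generate (integer_mod_group n) S \<noteq> carrier (integer_mod_group n)"
proof -
  have "int d dvd x" if "x \<in> generate (integer_mod_group n) S" for x
    using that
  proof induction
    case (inv h)
    then show ?case using assms(1,4,5) by (simp add: subset_iff dvd_mod)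
  qed (use assms in \<open>auto simp: dvd_mod\<close>)
  moreover have "1 \<in> carrier (integer_mod_group n)"
    using assms by auto
  ultimately show ?thesis using assms(2) by (metis int_dvd_int_iff of_nat_1 nat_dvd_1_iff_1)
qed

section \<open>Perfect codes in Cayley digraphs of prime square order\<close>

theorem theorem5p1:
  fixes p :: nat and S C :: "int set"
  assumes "prime p"
    and "S \<subset> carrier (integer_mod_group (p^2)) - {0}"
    and "generate (integer_mod_group (p^2)) S = carrier (integer_mod_group (p^2))"
    and "0 \<in> C" and "C \<subseteq> carrier (integer_mod_group (p^2))"
  shows "perfect_code (with_proj (cayley_digraph (integer_mod_group (p^2)) S)) C \<longleftrightarrow>
    (\<exists>\<alpha> :: nat \<Rightarrow> int.
       (\<forall>i<p. \<alpha> i \<in> carrier (integer_mod_group (p^2))) \<and> \<alpha> 0 = 0 \<and>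
       S \<union> {0} = {(int i + \<alpha> i * int p) mod int (p^2) | i. i < p}) \<and>
    C = {(int i * int p) mod int (p^2) | i. i < p}"
proof -
  let ?Z = "integer_mod_group (p ^ 2)" and ?M = "(\<lambda>i. int i * int p) ` {..<p}"
  let ?tiles = "\<lambda>A B. bij_betw (\<lambda>(a, b). (a + b) mod int (p ^ 2)) (A \<times> B) {0..<int (p ^ 2)}"
  have p: "p > 1" using assms(1) by (rule prime_gt_1_nat)
  have carr: "carrier ?Z = {0..<int (p ^ 2)}"
    using p by (simp add: carrier_integer_mod_group)
  have S: "S \<subseteq> carrier ?Z" "0 \<notin> S" using assms(2) by auto
  have S0: "S \<union> {0} \<subseteq> {0..<int (p ^ 2)}" "S \<union> {0} \<noteq> {0..<int (p ^ 2)}"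
    using assms(2) p unfolding carr by auto
  have not_sub: "\<not> (\<forall>s\<in>S. int p dvd s)"
    using generate_multiples_neq_carrier[of p "p ^ 2" S] S(1) assms(3) p by auto
  have "S \<union> {0} \<noteq> {0}" using not_sub by auto
  moreover have "S \<union> {0} \<noteq> ?M"
  proof
    assume "S \<union> {0} = ?M"
    then have "S \<subseteq> ?M" by blast
    then show False using not_sub by auto
  qed
  ultimately have C: "C = ?M" if "?tiles (S \<union> {0}) C"
    using prime_square_factorization_int[OF assms(1) S0(1) _ _ assms(4) that] assms(5) S0(2)
    unfolding carr by auto
  have M: "{(int i * int p) mod int (p ^ 2) | i. i < p} = ?M"
  proof -
    have "(int i * int p) mod int (p ^ 2) = int i * int p" if "i < p" for i
      using that by (simp add: power2_eq_square)
    then show ?thesis by (auto simp: setcompr_eq_image intro!: image_cong)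
  qed
  have "perfect_code (with_proj (cayley_digraph ?Z S)) C \<longleftrightarrow> ?tiles (S \<union> {0}) C"
    using p S(1) assms(5) by (intro perfect_code_iff_bij_betw) auto
  also have "\<dots> \<longleftrightarrow> ?tiles (S \<union> {0}) ?M \<and> C = ?M"
    using C by blast
  also have "?tiles (S \<union> {0}) ?M \<longleftrightarrow> bij_betw (\<lambda>a. a mod int p) (S \<union> {0}) {0..<int p}"
    using p S0(1) by (intro bij_betw_multiples_iff_transversal) auto
  also have "\<dots> \<longleftrightarrow> (\<exists>\<alpha> :: nat \<Rightarrow> int. (\<forall>i<p. \<alpha> i \<in> {0..<int (p ^ 2)}) \<and> \<alpha> 0 = 0 \<and>
      S \<union> {0} = {(int i + \<alpha> i * int p) mod int (p ^ 2) | i. i < p})"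
    using p S0(1) by (intro transversal_iff_shifted_residues) auto
  finally show ?thesis
    unfolding carr M .
qed

end
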